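(* Let $\beta\le\alpha$ be ordinals. If $\mathfrak{A}=\langle A,*_\kappa,v_\kappa\rangle_{\kappa<\alpha}$ is a representable substitution algebra of dimension $\alpha$, then its $\beta$-reduct $\mathfrak{A}/\beta=\langle A,*_\kappa,v_\kappa\rangle_{\kappa<\beta}$ is a representable substitution algebra of dimension $\beta$.
   Context: For an ordinal $\gamma$ and nonempty set $U$, $F_\gamma(U)$ is the set of all functions $U^\gamma\to U$. For $s\in U^\gamma$, $\kappa<\gamma$, $x\in U$, $s\langle\kappa,x\rangle$ agrees with $s$ except that its $\kappa$-th entry is $x$. On $F_\gamma(U)$ set $(f*_\kappa g)(s)=g(s\langle\kappa,f(s)\rangle)$ and $V_\kappa(s)=s_\kappa$. A function substitution algebra of dimension $\gamma$ is $\langle A,*_\kappa,V_\kappa\rangle_{\kappa<\gamma}$ with $A\subseteq F_\gamma(U)$ closed under every $*_\kappa$ and containing every $V_\kappa$. A substitution algebra of dimension $\gamma$ is an algebra $\langle A,*_\kappa,v_\kappa\rangle_{\kappa<\gamma}$ satisfying, for all $\kappa,\lambda<\gamma$: (1) $x*_\kappa v_\kappa=x$; (2) $x*_\kappa v_\lambda=v_\lambda$ for $\kappa\neq\lambda$; (3) $v_\kappa*_\kappa x=x$; (4) if $w*_\lambda x=x$ for all $w$, then $x*_\lambda(v_\lambda*_\kappa z)=x*_\lambda(x*_\kappa z)$; (5) $(x*_\kappa y)*_\kappa z=x*_\kappa(y*_\kappa z)$; (6) if $w*_\lambda x=x$ for all $w$, then $x*_\kappa(y*_\lambda z)=(x*_\kappa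 y)*_\lambda(x*_\kappa z)$ for $\kappa\neq\lambda$. It is representable if it is isomorphic to a function substitution algebra of dimension $\gamma$. *)

theory Defs
  imports "HOL-Library.FuncSet"
begin

text \<open>
  An ordinal \<open>\<gamma>\<close> is given by a well-order \<open>\<gamma> :: 'i rel\<close> (of arbitrary type \<open>'i\<close>); the indices
  \<open>\<kappa> < \<gamma>\<close> are the elements of \<open>Field \<gamma>\<close>.  As for von Neumann ordinals, \<open>\<beta> \<le> \<alpha>\<close> means that \<open>\<beta>\<close> is an
  initial segment of \<open>\<alpha>\<close>, i.e. \<open>\<beta> initial_segment_of \<alpha>\<close>.
\<close>

record ('i, 'a) subst_struct =
  carr :: "'a set"
  sub :: "'i \<Rightarrow> 'a \<Rightarrow> 'a \<Rightarrow> 'a"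
  var :: "'i \<Rightarrow> 'a"

locale substitution_algebra =
  fixes \<gamma> :: "'i rel" and \<AA> :: "('i, 'a) subst_struct"
  assumes sub_closed:
      "\<lbrakk>\<kappa> \<in> Field \<gamma>; x \<in> carr \<AA>; y \<in> carr \<AA>\<rbrakk> \<Longrightarrow> sub \<AA> \<kappa> x y \<in> carr \<AA>"
    and var_closed:
      "\<kappa> \<in> Field \<gamma> \<Longrightarrow> var \<AA> \<kappa> \<in> carr \<AA>"
    and ax1: "\<lbrakk>\<kappa> \<in> Field \<gamma>; x \<in> carr \<AA>\<rbrakk> \<Longrightarrow> sub \<AA> \<kappa> x (var \<AA> \<kappa>) = x"
    and ax2: "\<lbrakk>\<kappa> \<in> Field \<gamma>; \<mu> \<in> Field \<gamma>; \<kappa> \<noteq> \<mu>; x \<in> carr \<AA>\<rbrakk>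
      \<Longrightarrow> sub \<AA> \<kappa> x (var \<AA> \<mu>) = var \<AA> \<mu>"
    and ax3: "\<lbrakk>\<kappa> \<in> Field \<gamma>; x \<in> carr \<AA>\<rbrakk> \<Longrightarrow> sub \<AA> \<kappa> (var \<AA> \<kappa>) x = x"
    and ax4: "\<lbrakk>\<kappa> \<in> Field \<gamma>; \<mu> \<in> Field \<gamma>; x \<in> carr \<AA>; z \<in> carr \<AA>;
        \<forall>w\<in>carr \<AA>. sub \<AA> \<mu> w x = x\<rbrakk>
      \<Longrightarrow> sub \<AA> \<mu> x (sub \<AA> \<kappa> (var \<AA> \<mu>) z) = sub \<AA> \<mu> x (sub \<AA> \<kappa> x z)"
    and ax5: "\<lbrakk>\<kappa> \<in> Field \<gamma>; x \<in> carr \<AA>; y \<in> carr \<AA>; z \<in> carr \<AA>\<rbrakk>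
      \<Longrightarrow> sub \<AA> \<kappa> (sub \<AA> \<kappa> x y) z = sub \<AA> \<kappa> x (sub \<AA> \<kappa> y z)"
    and ax6: "\<lbrakk>\<kappa> \<in> Field \<gamma>; \<mu> \<in> Field \<gamma>; \<kappa> \<noteq> \<mu>;
        x \<in> carr \<AA>; y \<in> carr \<AA>; z \<in> carr \<AA>; \<forall>w\<in>carr \<AA>. sub \<AA> \<mu> w x = x\<rbrakk>
      \<Longrightarrow> sub \<AA> \<kappa> x (sub \<AA> \<mu> y z) = sub \<AA> \<mu> (sub \<AA> \<kappa> x y) (sub \<AA> \<kappa> x z)"

definition reduct :: "('i, 'a) subst_struct \<Rightarrow> 'i rel \<Rightarrow> ('i, 'a) subst_struct" where
  "reduct \<AA> \<beta> =
     \<lparr>carr = carr \<AA>, sub = restrict (sub \<AA>) (Field \<beta>), var = restrict (var \<AA>) (Field \<beta>)\<rparr>"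

definition subst_iso ::
  "'i rel \<Rightarrow> ('i, 'a) subst_struct \<Rightarrow> ('i, 'b) subst_struct \<Rightarrow> ('a \<Rightarrow> 'b) \<Rightarrow> bool" where
  "subst_iso \<gamma> \<AA> \<BB> h \<longleftrightarrow> bij_betw h (carr \<AA>) (carr \<BB>) \<and>
     (\<forall>\<kappa>\<in>Field \<gamma>. h (var \<AA> \<kappa>) = var \<BB> \<kappa> \<and>
        (\<forall>x\<in>carr \<AA>. \<forall>y\<in>carr \<AA>. h (sub \<AA> \<kappa> x y) = sub \<BB> \<kappa> (h x) (h y)))"

abbreviation tuples :: "'i rel \<Rightarrow> 'u set \<Rightarrow> ('i \<Rightarrow> 'u) set" where
  "tuples \<gamma> U \<equiv> Field \<gamma> \<rightarrow>\<^sub>E U"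

definition fun_sub ::
  "'i rel \<Rightarrow> 'u set \<Rightarrow> 'i \<Rightarrow> (('i \<Rightarrow> 'u) \<Rightarrow> 'u) \<Rightarrow> (('i \<Rightarrow> 'u) \<Rightarrow> 'u) \<Rightarrow> (('i \<Rightarrow> 'u) \<Rightarrow> 'u)" where
  "fun_sub \<gamma> U \<kappa> f g = (\<lambda>s\<in>tuples \<gamma> U. g (s(\<kappa> := f s)))"

definition fun_var :: "'i rel \<Rightarrow> 'u set \<Rightarrow> 'i \<Rightarrow> (('i \<Rightarrow> 'u) \<Rightarrow> 'u)" where
  "fun_var \<gamma> U \<kappa> = (\<lambda>s\<in>tuples \<gamma> U. s \<kappa>)"

definition function_substitution_algebra ::
  "'i rel \<Rightarrow> 'u set \<Rightarrow> ('i, ('i \<Rightarrow> 'u) \<Rightarrow> 'u) subst_struct \<Rightarrow> bool" where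
  "function_substitution_algebra \<gamma> U \<FF> \<longleftrightarrow>
     U \<noteq> {} \<and> carr \<FF> \<subseteq> tuples \<gamma> U \<rightarrow>\<^sub>E U \<and> sub \<FF> = fun_sub \<gamma> U \<and> var \<FF> = fun_var \<gamma> U \<and>
     (\<forall>\<kappa>\<in>Field \<gamma>. fun_var \<gamma> U \<kappa> \<in> carr \<FF> \<and>
        (\<forall>f\<in>carr \<FF>. \<forall>g\<in>carr \<FF>. fun_sub \<gamma> U \<kappa> f g \<in> carr \<FF>))"

definition representable_over :: "'u itself \<Rightarrow> 'i rel \<Rightarrow> ('i, 'a) subst_struct \<Rightarrow> bool" where
  "representable_over _ \<gamma> \<AA> \<longleftrightarrow>
     (\<exists>(U :: 'u set) \<FF> h. function_substitution_algebra \<gamma> U \<FF> \<and> subst_iso \<gamma> \<AA> \<FF> h)"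

text \<open>
  Representability quantifies existentially over base sets \<open>U\<close> in any universe, and HOL cannot
  quantify over types.  The type \<open>('i, 'a) base\<close> is large enough that this is no restriction:
  by \<open>representable_over_imp_representable\<close> below, an algebra with a base set in any type
  whatsoever also has one in \<open>('i, 'a) base\<close>.
\<close>

datatype ('i, 'a) base = Point 'a 'a 'i | Apply 'a "'i \<Rightarrow> ('i, 'a) base"

definition representable :: "'i rel \<Rightarrow> ('i, 'a) subst_struct \<Rightarrow> bool" where
  "representable \<gamma> \<AA> \<longleftrightarrow> representable_over TYPE(('i, 'a) base) \<gamma> \<AA>"

primrec base_val ::
  "('a \<Rightarrow> 'a \<Rightarrow> 'i \<Rightarrow> 'u) \<Rightarrow> ('a \<Rightarrow> ('i \<Rightarrow> 'u) \<Rightarrow> 'u) \<Rightarrow> ('i, 'a) base \<Rightarrow> 'u" where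
  "base_val p q (Point x y i) = p x y i"
| "base_val p q (Apply x t) = q x (\<lambda>i. base_val p q (t i))"

theorem representable_over_imp_representable:
  fixes \<AA> :: "('i, 'a) subst_struct"
  assumes alg: "substitution_algebra \<gamma> \<AA>"
    and rep: "representable_over TYPE('u) \<gamma> \<AA>"
  shows "representable \<gamma> \<AA>"
proof -
  let ?A = "carr \<AA>" and ?I = "Field \<gamma>"
  obtain U :: "'u set" and \<FF> h where
    F: "function_substitution_algebra \<gamma> U \<FF>" and h: "subst_iso \<gamma> \<AA> \<FF> h"
    using rep unfolding representable_over_def by blast
  obtain u0 where u0: "u0 \<in> U"
    using F unfolding function_substitution_algebra_def by blast
  have hF: "h x \<in> tuples \<gamma> U \<rightarrow>\<^sub>E U" if "x \<in> ?A" for x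
    using that F h unfolding function_substitution_algebra_def subst_iso_def bij_betw_def by blast
  have hinj: "inj_on h ?A"
    using h unfolding subst_iso_def bij_betw_def by blast
  have hsub: "h (sub \<AA> \<kappa> x y) = fun_sub \<gamma> U \<kappa> (h x) (h y)"
    if "\<kappa> \<in> ?I" "x \<in> ?A" "y \<in> ?A" for \<kappa> x y
    using that F h unfolding function_substitution_algebra_def subst_iso_def by simp
  have hvar: "h (var \<AA> \<kappa>) = fun_var \<gamma> U \<kappa>" if "\<kappa> \<in> ?I" for \<kappa>
    using that F h unfolding function_substitution_algebra_def subst_iso_def by simp
  have "\<exists>s\<in>tuples \<gamma> U. h x s \<noteq> h y s" if "x \<in> ?A" "y \<in> ?A" "x \<noteq> y" for x y
    using PiE_ext[OF hF[OF that(1)] hF[OF that(2)]] that inj_onD[OF hinj] by blast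
  then obtain p where p: "\<And>x y. x \<in> ?A \<Longrightarrow> y \<in> ?A \<Longrightarrow> x \<noteq> y \<Longrightarrow>
      p x y \<in> tuples \<gamma> U \<and> h x (p x y) \<noteq> h y (p x y)"
    by metis
  define P where "P x y i = (if x \<in> ?A \<and> y \<in> ?A \<and> x \<noteq> y \<and> i \<in> ?I then p x y i else u0)"
    for x y i
  define Q where "Q x t = (if x \<in> ?A then h x (restrict t ?I) else u0)" for x and t :: "'i \<Rightarrow> 'u"
  define ev where "ev = base_val P Q"
  have evU: "ev b \<in> U" for b
  proof (induction b)
    case (Point x y i)
    then show ?case using p[of x y] u0 unfolding ev_def P_def by (auto dest: PiE_mem)
  next
    case (Apply x t)
    then have t: "restrict (\<lambda>i. ev (t i)) ?I \<in> tuples \<gamma> U" by auto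
    have "h x (restrict (\<lambda>i. ev (t i)) ?I) \<in> U" if "x \<in> ?A"
      using PiE_mem[OF hF[OF that] t] .
    then show ?case using u0 unfolding ev_def by (simp add: Q_def)
  qed
  define code where "code = inv ev"
  have code: "ev (code (ev b)) = ev b" for b
    unfolding code_def by (simp add: f_inv_into_f)
  define W where "W = code ` range ev"
  have codeev: "code (ev b) = b" if "b \<in> W" for b
    using that code unfolding W_def by auto
  define tr where "tr s = (\<lambda>i\<in>?I. ev (s i))" for s
  have trU: "tr s \<in> tuples \<gamma> U" for s
    unfolding tr_def using evU by auto
  define k where "k x = (\<lambda>s\<in>tuples \<gamma> W. code (h x (tr s)))" for x
  have evk: "ev (k x s) = h x (tr s)" "k x s \<in> W" if "x \<in> ?A" "s \<in> tuples \<gamma> W" for x s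
  proof -
    have "h x (tr s) = ev (Apply x s)"
      using that unfolding ev_def tr_def by (simp add: Q_def)
    then show "ev (k x s) = h x (tr s)" "k x s \<in> W"
      using that code unfolding k_def W_def by auto
  qed
  have upd: "s(\<kappa> := b) \<in> tuples \<gamma> W" if "s \<in> tuples \<gamma> W" "\<kappa> \<in> ?I" "b \<in> W" for s \<kappa> b
    using that by (auto simp: PiE_iff extensional_def)
  have trupd: "tr (s(\<kappa> := b)) = (tr s)(\<kappa> := ev b)" if "\<kappa> \<in> ?I" for s \<kappa> b
    using that unfolding tr_def by auto
  have ksub: "k (sub \<AA> \<kappa> x y) = fun_sub \<gamma> W \<kappa> (k x) (k y)"
    if "\<kappa> \<in> ?I" "x \<in> ?A" "y \<in> ?A" for \<kappa> x y
  proof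
    fix s
    show "k (sub \<AA> \<kappa> x y) s = fun_sub \<gamma> W \<kappa> (k x) (k y) s"
    proof (cases "s \<in> tuples \<gamma> W")
      case True
      have "k (sub \<AA> \<kappa> x y) s = code (h y ((tr s)(\<kappa> := h x (tr s))))"
        using True trU hsub[OF that] unfolding k_def fun_sub_def by simp
      also have "\<dots> = code (h y (tr (s(\<kappa> := k x s))))"
        using trupd[OF that(1)] evk(1)[OF that(2) True] by simp
      also have "\<dots> = k y (s(\<kappa> := k x s))"
        using upd[OF True that(1) evk(2)[OF that(2) True]] unfolding k_def[of y] by simp
      finally show ?thesis using True unfolding fun_sub_def by simp
    next
      case False
      then show ?thesis unfolding k_def fun_sub_def by simp
    qed
  qed
  have kvar: "k (var \<AA> \<kappa>) = fun_var \<gamma> W \<kappa>" if "\<kappa> \<in> ?I" for \<kappa>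
  proof
    fix s
    show "k (var \<AA> \<kappa>) s = fun_var \<gamma> W \<kappa> s"
    proof (cases "s \<in> tuples \<gamma> W")
      case True
      then have "s \<kappa> \<in> W" using that by auto
      then show ?thesis
        using True that trU hvar[OF that] codeev unfolding k_def fun_var_def by (simp add: tr_def)
    next
      case False
      then show ?thesis unfolding k_def fun_var_def by simp
    qed
  qed
  have kinj: "inj_on k ?A"
  proof (rule inj_onI, rule ccontr)
    fix x y assume xy: "x \<in> ?A" "y \<in> ?A" "k x = k y" "x \<noteq> y"
    define s where "s = (\<lambda>i\<in>?I. code (ev (Point x y i)))"
    have s: "s \<in> tuples \<gamma> W" unfolding s_def W_def by auto
    have "tr s = p x y"
    proof
      fix i show "tr s i = p x y i"
      proof (cases "i \<in> ?I")
        case True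
        then have "tr s i = ev (Point x y i)" unfolding tr_def s_def using code by simp
        then show ?thesis using True xy unfolding ev_def by (simp add: P_def)
      next
        case False
        then have "p x y i = undefined" using PiE_arb[OF conjunct1[OF p[OF xy(1,2,4)]]] by blast
        then show ?thesis using False unfolding tr_def by simp
      qed
    qed
    then have "h x (p x y) = h y (p x y)"
      using evk(1)[OF xy(1) s] evk(1)[OF xy(2) s] xy(3) by simp
    then show False using p[OF xy(1,2,4)] by blast
  qed
  let ?F = "\<lparr>carr = k ` ?A, sub = fun_sub \<gamma> W, var = fun_var \<gamma> W\<rparr>"
  interpret substitution_algebra \<gamma> \<AA> by (rule alg)
  have "function_substitution_algebra \<gamma> W ?F"
    unfolding function_substitution_algebra_def
  proof (intro conjI ballI)
    show "W \<noteq> {}" unfolding W_def by simp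
    show "carr ?F \<subseteq> tuples \<gamma> W \<rightarrow>\<^sub>E W"
    proof
      fix f assume "f \<in> carr ?F"
      then obtain x where x: "x \<in> ?A" "f = k x" by auto
      show "f \<in> tuples \<gamma> W \<rightarrow>\<^sub>E W"
      proof (rule PiE_I)
        show "f s \<in> W" if "s \<in> tuples \<gamma> W" for s using evk(2)[OF x(1) that] x(2) by simp
        show "f s = undefined" if "s \<notin> tuples \<gamma> W" for s using that x(2) unfolding k_def by simp
      qed
    qed
    show "fun_var \<gamma> W \<kappa> \<in> carr ?F" if "\<kappa> \<in> ?I" for \<kappa>
      using kvar[OF that, symmetric] var_closed[OF that] by simp
    show "fun_sub \<gamma> W \<kappa> f g \<in> carr ?F"
      if "\<kappa> \<in> ?I" "f \<in> carr ?F" "g \<in> carr ?F" for \<kappa> f g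
      using that sub_closed ksub[symmetric] by auto
  qed simp_all
  moreover have "subst_iso \<gamma> \<AA> ?F k"
    unfolding subst_iso_def using ksub kvar kinj by (simp add: bij_betw_def)
  ultimately show ?thesis
    unfolding representable_def representable_over_def by blast
qed

end

(* Let A be represented by functions on the base set U.  Take F_alpha(U) itself as the new base set,
   and let f act on a beta-tuple t of such functions pointwise: at s in U^alpha, overwrite the
   entries of s below beta by the values t_kappa(s) and apply f.  Substitution and variables below
   beta are respected, and f is recovered as its value at the tuple of projections, so the action
   is faithful. *)

theory Submission
  imports Defs
begin

text \<open>The carrier is unchanged, so the side condition "for all \<open>w\<close>" in
  \<open>ax4\<close> and \<open>ax6\<close> means the same in the reduct, and each axiom is an
  instance of the original one.\<close>

lemma substitution_algebra_reduct:
  assumes "substitution_algebra \<alpha> \<AA>" and "Field \<beta> \<subseteq> Field \<alpha>"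
  shows "substitution_algebra \<beta> (reduct \<AA> \<beta>)"
proof -
  interpret substitution_algebra \<alpha> \<AA> by fact
  have sub: "sub (reduct \<AA> \<beta>) \<kappa> = sub \<AA> \<kappa>" and var: "var (reduct \<AA> \<beta>) \<kappa> = var \<AA> \<kappa>"
    if "\<kappa> \<in> Field \<beta>" for \<kappa>
    using that by (simp_all add: reduct_def)
  have carr: "carr (reduct \<AA> \<beta>) = carr \<AA>"
    by (simp add: reduct_def)
  show ?thesis
    by (unfold_locales; simp only: sub var carr;
        (rule sub_closed var_closed ax1 ax2 ax3 ax4 ax5 ax6; use assms(2) in blast))
qed

definition overwrite ::
  "'i rel \<Rightarrow> ('i \<Rightarrow> ('i \<Rightarrow> 'u) \<Rightarrow> 'u) \<Rightarrow> ('i \<Rightarrow> 'u) \<Rightarrow> ('i \<Rightarrow> 'u)" where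
  "overwrite \<beta> t s = (\<lambda>\<kappa>. if \<kappa> \<in> Field \<beta> then t \<kappa> s else s \<kappa>)"

text \<open>The inner restriction makes each value an element of the new base set, the outer one
  makes the lift a function on \<beta>-tuples over that base. Both matter because the representing
  algebra demands extensional functions.\<close>

definition pointwise_lift ::
  "'i rel \<Rightarrow> 'i rel \<Rightarrow> 'u set \<Rightarrow> (('i \<Rightarrow> 'u) \<Rightarrow> 'u) \<Rightarrow>
    (('i \<Rightarrow> ('i \<Rightarrow> 'u) \<Rightarrow> 'u) \<Rightarrow> ('i \<Rightarrow> 'u) \<Rightarrow> 'u)" where
  "pointwise_lift \<alpha> \<beta> U f =
     (\<lambda>t\<in>tuples \<beta> (tuples \<alpha> U \<rightarrow>\<^sub>E U). \<lambda>s\<in>tuples \<alpha> U. f (overwrite \<beta> t s))"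

text \<open>Changing one component of a tuple of functions amounts, at each \<open>s\<close>, to
  changing one entry of the overwritten tuple. Substitution is transported through this
  identity.\<close>

lemma overwrite_upd:
  "\<kappa> \<in> Field \<beta> \<Longrightarrow> overwrite \<beta> (t(\<kappa> := w)) s = (overwrite \<beta> t s)(\<kappa> := w s)"
  by (auto simp: overwrite_def)

lemma overwrite_tuples:
  assumes "Field \<beta> \<subseteq> Field \<alpha>" and "t \<in> tuples \<beta> (tuples \<alpha> U \<rightarrow>\<^sub>E U)" and "s \<in> tuples \<alpha> U"
  shows "overwrite \<beta> t s \<in> tuples \<alpha> U"
  using assms by (auto simp: overwrite_def PiE_iff extensional_def)

lemma pointwise_lift_closed:
  assumes "Field \<beta> \<subseteq> Field \<alpha>" and "f \<in> tuples \<alpha> U \<rightarrow>\<^sub>E U"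
  shows "pointwise_lift \<alpha> \<beta> U f
    \<in> tuples \<beta> (tuples \<alpha> U \<rightarrow>\<^sub>E U) \<rightarrow>\<^sub>E (tuples \<alpha> U \<rightarrow>\<^sub>E U)"
  unfolding pointwise_lift_def
  by (intro restrict_PiE_iff[THEN iffD2] ballI PiE_mem[OF assms(2)] overwrite_tuples[OF assms(1)])

text \<open>For \<kappa> in \<open>Field \<beta>\<close> the projection reads an entry that has been
  overwritten, hence returns \<open>t \<kappa> s\<close>.\<close>

lemma pointwise_lift_fun_var:
  assumes "Field \<beta> \<subseteq> Field \<alpha>" and "\<kappa> \<in> Field \<beta>"
  shows "pointwise_lift \<alpha> \<beta> U (fun_var \<alpha> U \<kappa>) = fun_var \<beta> (tuples \<alpha> U \<rightarrow>\<^sub>E U) \<kappa>"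
proof -
  have "(\<lambda>s\<in>tuples \<alpha> U. fun_var \<alpha> U \<kappa> (overwrite \<beta> t s)) = t \<kappa>"
    if t: "t \<in> tuples \<beta> (tuples \<alpha> U \<rightarrow>\<^sub>E U)" for t
  proof
    fix s
    show "(\<lambda>s\<in>tuples \<alpha> U. fun_var \<alpha> U \<kappa> (overwrite \<beta> t s)) s = t \<kappa> s"
    proof (cases "s \<in> tuples \<alpha> U")
      case True
      then show ?thesis
        using overwrite_tuples[OF assms(1) t True] assms(2)
        by (simp add: fun_var_def overwrite_def)
    next
      \<comment> \<open>Off \<open>tuples \<alpha> U\<close> both sides are
        \<open>undefined\<close>, since \<open>t \<kappa>\<close> is itself an extensional
        function.\<close>
      case False
      then show ?thesis
        using PiE_arb[OF PiE_mem[OF t assms(2)] False] by simp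
    qed
  qed
  then show ?thesis
    unfolding pointwise_lift_def fun_var_def[of \<beta>] by (intro restrict_ext)
qed

text \<open>At a fixed \<open>s\<close> the lifts of \<open>f\<close> and \<open>g\<close> act on
  the same tuple \<open>overwrite \<beta> t s\<close>. Putting the value of \<open>f\<close> there
  into entry \<kappa> agrees with first replacing \<open>t \<kappa>\<close> by the lift of
  \<open>f\<close> at \<open>t\<close>, because that function takes precisely this value at
  \<open>s\<close>.\<close>

lemma pointwise_lift_fun_sub:
  assumes "Field \<beta> \<subseteq> Field \<alpha>" and "\<kappa> \<in> Field \<beta>" and "f \<in> tuples \<alpha> U \<rightarrow>\<^sub>E U"
  shows "pointwise_lift \<alpha> \<beta> U (fun_sub \<alpha> U \<kappa> f g) =
    fun_sub \<beta> (tuples \<alpha> U \<rightarrow>\<^sub>E U) \<kappa> (pointwise_lift \<alpha> \<beta> U f) (pointwise_lift \<alpha> \<beta> U g)"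
    (is "?L = fun_sub \<beta> ?W \<kappa> ?f ?g")
proof
  fix t
  show "?L t = fun_sub \<beta> ?W \<kappa> ?f ?g t"
  proof (cases "t \<in> tuples \<beta> ?W")
    case True
    \<comment> \<open>\<open>?g\<close> is given by its formula only on
      \<open>tuples \<beta> ?W\<close>, so the updated tuple must be seen to stay inside.\<close>
    have "?f t \<in> ?W"
      using PiE_mem[OF pointwise_lift_closed[OF assms(1,3)] True] .
    then have upd: "t(\<kappa> := ?f t) \<in> tuples \<beta> ?W"
      using True assms(2) by (auto simp: PiE_iff extensional_def)
    have "?L t = (\<lambda>s\<in>tuples \<alpha> U. g ((overwrite \<beta> t s)(\<kappa> := f (overwrite \<beta> t s))))"
      using True overwrite_tuples[OF assms(1) True]
      by (auto simp: pointwise_lift_def fun_sub_def intro!: restrict_ext)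
    also have "\<dots> = (\<lambda>s\<in>tuples \<alpha> U. g (overwrite \<beta> (t(\<kappa> := ?f t)) s))"
      using True by (intro restrict_ext) (simp add: overwrite_upd[OF assms(2)] pointwise_lift_def)
    also have "\<dots> = ?g (t(\<kappa> := ?f t))"
      using upd by (simp add: pointwise_lift_def)
    finally show ?thesis
      using True by (simp add: fun_sub_def)
  next
    case False
    then show ?thesis
      by (simp add: pointwise_lift_def fun_sub_def)
  qed
qed

text \<open>Overwriting entries of \<open>s\<close> by projections evaluated at \<open>s\<close>
  gives back \<open>s\<close>. Thus a lift determines the function it came from, which yields
  faithfulness.\<close>

lemma pointwise_lift_projections:
  assumes "Field \<beta> \<subseteq> Field \<alpha>" and "f \<in> tuples \<alpha> U \<rightarrow>\<^sub>E U"
  shows "pointwise_lift \<alpha> \<beta> U f (\<lambda>\<kappa>\<in>Field \<beta>. fun_var \<alpha> U \<kappa>) = f"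
proof -
  let ?v = "\<lambda>\<kappa>\<in>Field \<beta>. fun_var \<alpha> U \<kappa>"
  have v: "?v \<in> tuples \<beta> (tuples \<alpha> U \<rightarrow>\<^sub>E U)"
    unfolding fun_var_def restrict_PiE_iff using assms(1) by (blast intro: PiE_mem)
  have "overwrite \<beta> ?v s = s" if "s \<in> tuples \<alpha> U" for s
    using that by (auto simp: overwrite_def fun_var_def)
  then have "pointwise_lift \<alpha> \<beta> U f ?v = restrict f (tuples \<alpha> U)"
    using v by (auto simp: pointwise_lift_def intro!: restrict_ext)
  then show ?thesis
    using assms(2) by (simp add: PiE_restrict)
qed

text \<open>The type of base points changes here because the points of the new base set are
  functions on \<alpha>-tuples over the old one.\<close>

lemma representable_over_reduct:
  fixes \<AA> :: "('i, 'a) subst_struct"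
  assumes alg: "substitution_algebra \<alpha> \<AA>" and \<beta>: "Field \<beta> \<subseteq> Field \<alpha>"
    and rep: "representable_over TYPE('u) \<alpha> \<AA>"
  shows "representable_over TYPE(('i \<Rightarrow> 'u) \<Rightarrow> 'u) \<beta> (reduct \<AA> \<beta>)"
proof -
  interpret substitution_algebra \<alpha> \<AA> by (rule alg)
  obtain U :: "'u set" and \<FF> h where
    F: "function_substitution_algebra \<alpha> U \<FF>" and h: "subst_iso \<alpha> \<AA> \<FF> h"
    using rep unfolding representable_over_def by blast
  have hF: "h x \<in> tuples \<alpha> U \<rightarrow>\<^sub>E U" if "x \<in> carr \<AA>" for x
    using that F h unfolding function_substitution_algebra_def subst_iso_def bij_betw_def by blast
  have hinj: "inj_on h (carr \<AA>)"
    using h unfolding subst_iso_def bij_betw_def by blast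
  have hsub: "h (sub \<AA> \<kappa> x y) = fun_sub \<alpha> U \<kappa> (h x) (h y)"
    if "\<kappa> \<in> Field \<alpha>" "x \<in> carr \<AA>" "y \<in> carr \<AA>" for \<kappa> x y
    using that F h unfolding function_substitution_algebra_def subst_iso_def by simp
  have hvar: "h (var \<AA> \<kappa>) = fun_var \<alpha> U \<kappa>" if "\<kappa> \<in> Field \<alpha>" for \<kappa>
    using that F h unfolding function_substitution_algebra_def subst_iso_def by simp
  let ?W = "tuples \<alpha> U \<rightarrow>\<^sub>E U"
  define k where "k x = pointwise_lift \<alpha> \<beta> U (h x)" for x
  have ksub: "k (sub \<AA> \<kappa> x y) = fun_sub \<beta> ?W \<kappa> (k x) (k y)"
    if "\<kappa> \<in> Field \<beta>" "x \<in> carr \<AA>" "y \<in> carr \<AA>" for \<kappa> x y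
    using that \<beta> hsub pointwise_lift_fun_sub[OF \<beta> that(1) hF[OF that(2)]]
    unfolding k_def by (metis subsetD)
  have kvar: "k (var \<AA> \<kappa>) = fun_var \<beta> ?W \<kappa>" if "\<kappa> \<in> Field \<beta>" for \<kappa>
    using that \<beta> hvar pointwise_lift_fun_var[OF \<beta> that] unfolding k_def by (metis subsetD)
  \<comment> \<open>Evaluating \<open>k x\<close> at the tuple of projections recovers
    \<open>h x\<close>, and \<open>h\<close> is injective.\<close>
  have kinj: "inj_on k (carr \<AA>)"
    using hinj pointwise_lift_projections[OF \<beta> hF] unfolding k_def inj_on_def by metis
  let ?F = "\<lparr>carr = k ` carr \<AA>, sub = fun_sub \<beta> ?W, var = fun_var \<beta> ?W\<rparr>"
  have "function_substitution_algebra \<beta> ?W ?F"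
    unfolding function_substitution_algebra_def
  proof (intro conjI ballI)
    show "?W \<noteq> {}"
      using F by (auto simp: function_substitution_algebra_def PiE_eq_empty_iff)
    show "carr ?F \<subseteq> tuples \<beta> ?W \<rightarrow>\<^sub>E ?W"
      using pointwise_lift_closed[OF \<beta> hF] by (simp add: k_def image_subset_iff)
    show "fun_var \<beta> ?W \<kappa> \<in> carr ?F" if "\<kappa> \<in> Field \<beta>" for \<kappa>
      using that \<beta> var_closed kvar[symmetric] by auto
    show "fun_sub \<beta> ?W \<kappa> f g \<in> carr ?F"
      if "\<kappa> \<in> Field \<beta>" "f \<in> carr ?F" "g \<in> carr ?F" for \<kappa> f g
      using that \<beta> sub_closed ksub[symmetric] by auto
  qed simp_all
  moreover have "subst_iso \<beta> (reduct \<AA> \<beta>) ?F k"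
    unfolding subst_iso_def reduct_def using ksub kvar kinj by (simp add: bij_betw_def)
  ultimately show ?thesis
    unfolding representable_over_def by blast
qed

theorem theorem5p2:
  fixes \<alpha> \<beta> :: "'i rel" and \<AA> :: "('i, 'a) subst_struct"
  assumes "Well_order \<alpha>" and "Well_order \<beta>" and "\<beta> initial_segment_of \<alpha>"
    and "substitution_algebra \<alpha> \<AA>" and "representable \<alpha> \<AA>"
  shows "substitution_algebra \<beta> (reduct \<AA> \<beta>) \<and> representable \<beta> (reduct \<AA> \<beta>)"
proof
  \<comment> \<open>An initial segment is in particular a subrelation, and \<open>Field\<close> is
    monotone.\<close>
  have \<beta>: "Field \<beta> \<subseteq> Field \<alpha>"
    using assms(3) by (auto simp: init_seg_of_def intro: mono_Field[THEN subsetD])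
  show alg: "substitution_algebra \<beta> (reduct \<AA> \<beta>)"
    using substitution_algebra_reduct[OF assms(4) \<beta>] .
  \<comment> \<open>The lifted representation has its base in a function type over
    \<open>('i, 'a) base\<close>; the transfer theorem brings it back to
    \<open>('i, 'a) base\<close>, using that the reduct is a substitution algebra.\<close>
  show "representable \<beta> (reduct \<AA> \<beta>)"
    using representable_over_imp_representable[OF alg]
      representable_over_reduct[OF assms(4) \<beta> assms(5)[unfolded representable_def]] .
qed

end
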